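(* Let $p\ge1$, let $h\in\mathbb{R}^p$ with $h_i\ne0$ for all $i\in[p]$, and let $f:\mathbb{R}\to\mathbb{R}$ be convex with $f(0)=0$. Let $Q_{\mathrm c}=\{z\in\{0,1\}^p:\mathbf 1^\top z\le q\}$ with $q=1$, and $$Z_{Q_{\mathrm c}}=\left\{(z,\beta,t)\in Q_{\mathrm c}\times\mathbb{R}^p\times\mathbb{R}\;:\; f(h^\top\beta)\le t,\ \beta_i(1-z_i)=0\ \ \forall i\in[p]\right\}.$$ Then $$\operatorname{cl\,conv}(Z_{Q_{\mathrm c}})=\Big\{(z,\beta,t)\in[0,1]^p\times\mathbb{R}^{p}\times\mathbb{R}\;:\;\mathbf 1^\top z\le 1,\ \sum_{i\in[p]}z_if\Big(\frac{h_i\beta_i}{z_i}\Big)\le t\Big\}.$$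
   Context: Notation: $[p]=\{1,\dots,p\}$; $\mathbf 1$ is the all-ones vector; $\operatorname{cl\,conv}$ is the closure of the convex hull. Convention for perspectives: for $w>0$ the expression $w f(x/w)$ is the usual one, and for $w=0$ it is understood as $0f(x/0):=\lim_{w\to0^+}w f(x/w)\in(-\infty,+\infty]$ (an inequality with left-hand side $+\infty$ is never satisfied by real $t$). *)

theory Defs
  imports "HOL-Analysis.Analysis"
begin

text \<open>
  The perspective \<open>w f (x / w)\<close>, with the limit convention at \<open>w = 0\<close>. The limit is taken in
  \<open>ereal\<close>, since it may be \<open>\<infinity>\<close>; for convex \<open>f\<close> with \<open>f 0 = 0\<close> it always exists and
  is not \<open>-\<infinity>\<close>, so that finite sums of perspectives are unproblematic. The value
  for \<open>w < 0\<close> is irrelevant.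
\<close>

definition persp :: "(real \<Rightarrow> real) \<Rightarrow> real \<Rightarrow> real \<Rightarrow> ereal" where
  "persp f w x =
     (if w = 0 then Lim (at_right 0) (\<lambda>u. ereal (u * f (x / u)))
      else ereal (w * f (x / w)))"

definition Q_card :: "nat \<Rightarrow> (real ^ 'p) set" where
  "Q_card q = {z. (\<forall>i. z $ i \<in> {0, 1}) \<and> (\<Sum>i\<in>UNIV. z $ i) \<le> real q}"

definition Z_set ::
  "(real \<Rightarrow> real) \<Rightarrow> real ^ 'p \<Rightarrow> (real ^ 'p) set \<Rightarrow> ((real ^ 'p) \<times> (real ^ 'p) \<times> real) set" where
  "Z_set f h Q =
     {(z, \<beta>, t). z \<in> Q \<and> f (h \<bullet> \<beta>) \<le> t \<and> (\<forall>i. \<beta> $ i * (1 - z $ i) = 0)}"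

end

theory Submission
  imports Defs
begin

text \<open>
  Everything rests on a dual description of the perspective. If \<open>M\<close> is the set of affine
  minorants \<open>y \<mapsto> a y + b\<close> of \<open>f\<close>, then for all \<open>w \<ge> 0\<close>, the limiting value at \<open>w = 0\<close> included,
  \<open>persp f w x\<close> is the supremum of \<open>a x + b w\<close> over \<open>(a, b) \<in> M\<close> (lemma \<open>persp_eq_SUP\<close>). A sum of
  perspectives is therefore at most \<open>t\<close> iff every choice of one minorant per coordinate
  satisfies a linear inequality, and the right-hand side of the theorem is an intersection of
  closed half-spaces (lemma \<open>persp_region_eq\<close>): it is closed and convex, and it is enough to
  test the points of \<open>Z_set f h (Q_card 1)\<close> against these inequalities. At such a point
  at most one coordinate is active, so the test reads \<open>a y + b \<le> f y\<close>, or \<open>0 \<le> t\<close> if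
  there is no active coordinate.

  Conversely, a point of the region with all \<open>z\<^sub>i > 0\<close> is an explicit convex combination: the
  point supported on coordinate \<open>i\<close> gets weight \<open>z\<^sub>i\<close>, and the origin gets the remaining
  weight \<open>1 - \<Sum>\<^sub>i z\<^sub>i\<close> (lemma \<open>mem_hull_of_pos\<close>). An arbitrary point of the region is a limit of
  such points, because by convexity it can be pushed towards the point
  \<open>((1/p, \<dots>, 1/p), 0, 0)\<close>, which lies in the region since \<open>f 0 = 0\<close>. This avoids any separate
  analysis of coordinates with \<open>z\<^sub>i = 0\<close> and \<open>\<beta>\<^sub>i \<noteq> 0\<close>.
\<close>

section \<open>Affine minorants and perspectives\<close>

definition affine_minorants :: "(real \<Rightarrow> real) \<Rightarrow> (real \<times> real) set" where
  "affine_minorants f = {(a, b). \<forall>y. a * y + b \<le> f y}"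

lemma convex_supporting_line:
  fixes f :: "real \<Rightarrow> real"
  assumes "convex_on UNIV f"
  obtains a where "(a, f x - a * x) \<in> affine_minorants f"
proof -
  define a where "a = Inf ((\<lambda>t. (f x - f t) / (x - t)) ` ({x<..} \<inter> UNIV))"
  have "f x + a * (y - x) \<le> f y" for y
    unfolding a_def using convex_le_Inf_differential[OF assms, of x y] by simp
  then have "(a, f x - a * x) \<in> affine_minorants f"
    by (simp add: affine_minorants_def algebra_simps)
  then show ?thesis by (rule that)
qed

lemma affine_minorants_nonempty:
  assumes "convex_on UNIV f"
  shows "affine_minorants f \<noteq> {}"
  using convex_supporting_line[OF assms, of 0] by blast

lemma affine_minorant_le_scaled:
  assumes "(a, b) \<in> affine_minorants f" "u > 0"
  shows "a * x + b * u \<le> u * f (x / u)"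
proof -
  have "a * (x / u) + b \<le> f (x / u)"
    using assms(1) unfolding affine_minorants_def by blast
  then have "u * (a * (x / u) + b) \<le> u * f (x / u)"
    using assms(2) by (intro mult_left_mono) auto
  moreover have "u * (a * (x / u) + b) = a * x + b * u"
    using assms(2) by (simp add: field_simps)
  ultimately show ?thesis by simp
qed

text \<open>
  For \<open>w > 0\<close> the supremum is attained by the supporting line at \<open>x / w\<close>. For \<open>w = 0\<close> it
  bounds the scaled values from above because the supporting line at \<open>x / u\<close> has nonpositive
  intercept (it lies below \<open>f\<close> at \<open>0\<close>), and it is approached because each minorant gives the
  lower bound \<open>a x + b u\<close>, which tends to \<open>a x\<close>.
\<close>

lemma persp_eq_SUP:
  assumes cv: "convex_on UNIV f" and f0: "f 0 = 0" and w: "w \<ge> 0"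
  shows "persp f w x = (SUP (a, b)\<in>affine_minorants f. ereal (a * x + b * w))"
proof (cases "w = 0")
  case False
  with w have w: "w > 0" by simp
  obtain a where a: "(a, f (x / w) - a * (x / w)) \<in> affine_minorants f"
    using convex_supporting_line[OF cv] .
  have "a * x + (f (x / w) - a * (x / w)) * w = w * f (x / w)"
    using w by (simp add: field_simps)
  then have "ereal (w * f (x / w)) \<le> (SUP (a, b)\<in>affine_minorants f. ereal (a * x + b * w))"
    using SUP_upper[OF a, of "\<lambda>(a, b). ereal (a * x + b * w)"] by simp
  moreover have "(SUP (a, b)\<in>affine_minorants f. ereal (a * x + b * w)) \<le> ereal (w * f (x / w))"
    by (intro SUP_least) (auto intro: affine_minorant_le_scaled[OF _ w])
  ultimately show ?thesis using w by (simp add: persp_def)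
next
  case True
  define S where "S = (SUP (a, b)\<in>affine_minorants f. ereal (a * x))"
  have upper: "ereal (u * f (x / u)) \<le> S" if u: "u > 0" for u
  proof -
    obtain a where a: "(a, f (x / u) - a * (x / u)) \<in> affine_minorants f"
      using convex_supporting_line[OF cv] .
    then have "f (x / u) - a * (x / u) \<le> f 0"
      unfolding affine_minorants_def
      by (metis (mono_tags, lifting) add_0 case_prodD mem_Collect_eq mult_zero_right)
    then have "u * f (x / u) \<le> a * x"
      using u f0 by (simp add: field_simps)
    also have "ereal (a * x) \<le> S"
      unfolding S_def using SUP_upper[OF a, of "\<lambda>(a, b). ereal (a * x)"] by simp
    finally show ?thesis by simp
  qed
  have "((\<lambda>u. ereal (u * f (x / u))) \<longlongrightarrow> S) (at_right 0)"
  proof (rule order_tendstoI)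
    fix c assume "c < S"
    then obtain a b where ab: "(a, b) \<in> affine_minorants f" and c: "c < ereal (a * x)"
      unfolding S_def less_SUP_iff by auto
    have "((\<lambda>u. ereal (a * x + b * u)) \<longlongrightarrow> ereal (a * x + b * 0)) (at_right 0)"
      by (intro tendsto_intros)
    then have "eventually (\<lambda>u. c < ereal (a * x + b * u)) (at_right 0)"
      using c by (intro order_tendstoD(1)) auto
    moreover have "eventually (\<lambda>u. u > 0) (at_right (0::real))"
      by (rule eventually_at_right_less)
    ultimately show "eventually (\<lambda>u. c < ereal (u * f (x / u))) (at_right 0)"
    proof eventually_elim
      case (elim u)
      with affine_minorant_le_scaled[OF ab elim(2), of x] show ?case
        by (metis ereal_less_eq(3) order_less_le_trans)
    qed
  next
    fix c assume c: "S < c"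
    have "eventually (\<lambda>u. u > 0) (at_right (0::real))"
      by (rule eventually_at_right_less)
    then show "eventually (\<lambda>u. ereal (u * f (x / u)) < c) (at_right 0)"
      by eventually_elim (use upper c in \<open>auto intro: order_le_less_trans\<close>)
  qed
  then have "Lim (at_right 0) (\<lambda>u. ereal (u * f (x / u))) = S"
    by (intro tendsto_Lim) auto
  then show ?thesis using True by (simp add: persp_def S_def)
qed

text \<open>
  The suprema are independent of each other, so a bound on their sum can be tested on one
  element per summand. The induction is over arbitrary \<open>t\<close>, since fixing the element \<open>m\<close> of
  summand \<open>j\<close> leaves the bound \<open>t - g j m\<close> for the others.
\<close>

lemma sum_SUP_le_iff:
  fixes g :: "'i \<Rightarrow> 'm \<Rightarrow> real"
  assumes "finite I" and M: "M \<noteq> {}"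
  shows "(\<Sum>i\<in>I. SUP m\<in>M. ereal (g i m)) \<le> ereal t \<longleftrightarrow>
    (\<forall>c. (\<forall>i\<in>I. c i \<in> M) \<longrightarrow> (\<Sum>i\<in>I. g i (c i)) \<le> t)"
  using assms(1)
proof (induction I arbitrary: t)
  case empty
  then show ?case by simp
next
  case (insert j I)
  let ?S = "\<Sum>i\<in>I. SUP m\<in>M. ereal (g i m)"
  \<comment> \<open>Neither the summands nor their sum are \<open>-\<infinity>\<close>, so that \<open>SUP\<close> commutes with addition.\<close>
  have SUP_neq: "(SUP m\<in>M. ereal (g i m)) \<noteq> -\<infinity>" for i
  proof -
    obtain m where "m \<in> M" using M by blast
    then have "ereal (g i m) \<le> (SUP m\<in>M. ereal (g i m))" by (rule SUP_upper)
    then show ?thesis by auto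
  qed
  have "(\<Sum>i\<in>J. SUP m\<in>M. ereal (g i m)) \<noteq> -\<infinity>" if "finite J" for J
    using that by (induction J rule: finite_induct) (simp_all add: SUP_neq)
  with insert.hyps(1) have S: "?S \<noteq> -\<infinity>" by blast
  have "(\<Sum>i\<in>insert j I. SUP m\<in>M. ereal (g i m)) \<le> ereal t \<longleftrightarrow>
      (SUP m\<in>M. ereal (g j m) + ?S) \<le> ereal t"
    using insert.hyps SUP_ereal_add_left[OF M S] by simp
  also have "\<dots> \<longleftrightarrow> (\<forall>m\<in>M. ?S \<le> ereal (t - g j m))"
  proof -
    have "ereal (g j m) + ?S \<le> ereal t \<longleftrightarrow> ?S \<le> ereal (t - g j m)" for m
      by (cases ?S) auto
    then show ?thesis by (simp add: SUP_le_iff)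
  qed
  also have "\<dots> \<longleftrightarrow> (\<forall>m\<in>M. \<forall>c. (\<forall>i\<in>I. c i \<in> M) \<longrightarrow> (\<Sum>i\<in>I. g i (c i)) \<le> t - g j m)"
    by (simp only: insert.IH)
  also have "\<dots> \<longleftrightarrow> (\<forall>c. (\<forall>i\<in>insert j I. c i \<in> M) \<longrightarrow> (\<Sum>i\<in>insert j I. g i (c i)) \<le> t)"
    (is "?L \<longleftrightarrow> ?R")
  proof
    assume ?L
    then show ?R using insert.hyps by (force simp: algebra_simps)
  next
    assume R: ?R
    show ?L
    proof (intro ballI allI impI)
      fix m c assume m: "m \<in> M" and c: "\<forall>i\<in>I. c i \<in> M"
      have "(\<Sum>i\<in>insert j I. g i ((c(j := m)) i)) \<le> t"
        using R m c by (metis fun_upd_apply insertE)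
      moreover have "(\<Sum>i\<in>I. g i ((c(j := m)) i)) = (\<Sum>i\<in>I. g i (c i))"
        using insert.hyps by (intro sum.cong) auto
      ultimately show "(\<Sum>i\<in>I. g i (c i)) \<le> t - g j m"
        using insert.hyps by simp
    qed
  qed
  finally show ?case .
qed

section \<open>The perspective region\<close>

definition persp_region ::
  "(real \<Rightarrow> real) \<Rightarrow> real ^ 'p \<Rightarrow> ((real ^ 'p) \<times> (real ^ 'p) \<times> real) set" where
  "persp_region f h = {(z, \<beta>, t). (\<forall>i. z $ i \<in> {0..1}) \<and> (\<Sum>i\<in>UNIV. z $ i) \<le> 1 \<and>
     (\<Sum>i\<in>UNIV. persp f (z $ i) (h $ i * \<beta> $ i)) \<le> ereal t}"

lemma persp_region_eq:
  fixes h :: "real ^ 'p"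
  assumes cv: "convex_on UNIV f" and f0: "f 0 = 0"
  shows "persp_region f h = {(z, \<beta>, t). (\<forall>i. z $ i \<in> {0..1}) \<and> (\<Sum>i\<in>UNIV. z $ i) \<le> 1 \<and>
     (\<forall>c. (\<forall>i. c i \<in> affine_minorants f) \<longrightarrow>
        (\<Sum>i\<in>UNIV. fst (c i) * (h $ i * \<beta> $ i) + snd (c i) * z $ i) \<le> t)}"
proof -
  have "(\<Sum>i\<in>UNIV. persp f (z $ i) (h $ i * \<beta> $ i)) \<le> ereal t \<longleftrightarrow>
     (\<forall>c. (\<forall>i. c i \<in> affine_minorants f) \<longrightarrow>
        (\<Sum>i\<in>UNIV. fst (c i) * (h $ i * \<beta> $ i) + snd (c i) * z $ i) \<le> t)"
    if "\<forall>i. z $ i \<in> {0..1}" for z \<beta> :: "real ^ 'p" and t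
  proof -
    have "persp f (z $ i) (h $ i * \<beta> $ i) =
        (SUP m\<in>affine_minorants f. ereal (fst m * (h $ i * \<beta> $ i) + snd m * z $ i))" for i
      using that by (subst persp_eq_SUP[OF cv f0]) (auto simp: case_prod_beta)
    then show ?thesis
      using sum_SUP_le_iff[OF finite affine_minorants_nonempty[OF cv],
        of "\<lambda>i m. fst m * (h $ i * \<beta> $ i) + snd m * z $ i"] by simp
  qed
  then show ?thesis unfolding persp_region_def by blast
qed

lemma closed_convex_persp_region:
  fixes h :: "real ^ 'p"
  assumes cv: "convex_on UNIV f" and f0: "f 0 = 0"
  shows closed_persp_region: "closed (persp_region f h)"
    and convex_persp_region: "convex (persp_region f h)"
proof -
  let ?l = "\<lambda>c (x :: (real ^ 'p) \<times> (real ^ 'p) \<times> real).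
    (\<Sum>i\<in>UNIV. fst (c i) * (h $ i * fst (snd x) $ i) + snd (c i) * fst x $ i)"
  have eq: "persp_region f h =
      (\<Inter>i. {x. 0 \<le> fst x $ i} \<inter> {x. fst x $ i \<le> 1}) \<inter> {x. (\<Sum>i\<in>UNIV. fst x $ i) \<le> 1} \<inter>
      (\<Inter>c\<in>{c. \<forall>i. c i \<in> affine_minorants f}. {x. ?l c x \<le> snd (snd x)})"
    unfolding persp_region_eq[OF cv f0] by auto
  show "closed (persp_region f h)"
    unfolding eq
    by (intro closed_Int closed_INT ballI closed_Collect_le continuous_intros)
  have conv_le: "convex {x. l x \<le> r}" if "linear l" for l :: "_ \<Rightarrow> real" and r
    using convex_linear_vimage[OF that convex_real_interval(2)[of r]] by (simp add: vimage_def)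
  have "linear (\<lambda>x :: (real ^ 'p) \<times> (real ^ 'p) \<times> real. fst x $ i)"
    "linear (\<lambda>x :: (real ^ 'p) \<times> (real ^ 'p) \<times> real. - fst x $ i)"
    "linear (\<lambda>x :: (real ^ 'p) \<times> (real ^ 'p) \<times> real. \<Sum>i\<in>UNIV. fst x $ i)"
    "linear (\<lambda>x. ?l c x - snd (snd x))"
    for i :: 'p and c
    by (rule linearI; simp add: sum.distrib sum_distrib_left algebra_simps)+
  note this[THEN conv_le]
  from this(1)[of _ 1] this(2)[of _ 0] this(3)[of 1] this(4)[of _ 0]
  show "convex (persp_region f h)"
    unfolding eq by (intro convex_Int convex_INT) simp_all
qed

lemma Z_set_subset_persp_region:
  fixes h :: "real ^ 'p"
  assumes cv: "convex_on UNIV f" and f0: "f 0 = 0"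
  shows "Z_set f h (Q_card 1) \<subseteq> persp_region f h"
proof safe
  fix z \<beta> :: "real ^ 'p" and t
  assume "(z, \<beta>, t) \<in> Z_set f h (Q_card 1)"
  then have z01: "\<And>i. z $ i \<in> {0, 1}" and zsum: "(\<Sum>i\<in>UNIV. z $ i) \<le> 1"
    and t: "f (h \<bullet> \<beta>) \<le> t" and comp: "\<And>i. \<beta> $ i * (1 - z $ i) = 0"
    by (auto simp: Z_set_def Q_card_def)
  have \<beta>0: "\<beta> $ i = 0" if "z $ i = 0" for i
    using comp[of i] that by simp
  have z_range: "z $ i \<in> {0..1}" for i
    using z01[of i] by auto
  have "(\<Sum>i\<in>UNIV. fst (c i) * (h $ i * \<beta> $ i) + snd (c i) * z $ i) \<le> t"
    if c: "\<And>i. c i \<in> affine_minorants f" for c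
  proof (cases "\<exists>j. z $ j = 1")
    case True
    then obtain j where j: "z $ j = 1" by blast
    have z0: "z $ i = 0" if "i \<noteq> j" for i
    proof (rule ccontr)
      assume "z $ i \<noteq> 0"
      then have "z $ i = 1" using z01[of i] by simp
      moreover have "(\<Sum>k\<in>{i, j}. z $ k) \<le> (\<Sum>k\<in>UNIV. z $ k)"
        using z_range by (intro sum_mono2) auto
      ultimately show False using that j zsum by simp
    qed
    have "h \<bullet> \<beta> = h $ j * \<beta> $ j"
      unfolding inner_vec_def using z0 \<beta>0 by (simp add: sum.remove[of _ j])
    moreover have "fst (c j) * (h $ j * \<beta> $ j) + snd (c j) \<le> f (h $ j * \<beta> $ j)"
      using c[of j] by (auto simp: affine_minorants_def case_prod_beta)
    ultimately show ?thesis
      using z0 \<beta>0 j t by (simp add: sum.remove[of _ j])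
  next
    case False
    then have "z $ i = 0" for i using z01[of i] by auto
    moreover from this have "\<beta> $ i = 0" for i using \<beta>0 by simp
    ultimately show ?thesis using t f0 by (simp add: inner_vec_def)
  qed
  then show "(z, \<beta>, t) \<in> persp_region f h"
    unfolding persp_region_eq[OF cv f0] using z_range zsum by blast
qed

section \<open>The region as a subset of the closed hull\<close>

text \<open>
  The combination of the points \<open>(e\<^sub>i, (\<beta>\<^sub>i / z\<^sub>i) e\<^sub>i, f (h\<^sub>i \<beta>\<^sub>i / z\<^sub>i))\<close> with weights \<open>z\<^sub>i\<close> and
  of the origin with the remaining weight has the components \<open>z\<close> and \<open>\<beta>\<close>, and its last component
  is the sum of perspectives. The slack \<open>s\<close> between this sum and \<open>t\<close> is added to the last
  component of every point, the origin included, so that the weights need not be changed.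
\<close>

lemma mem_hull_of_pos:
  fixes h :: "real ^ 'p"
  assumes f0: "f 0 = 0"
    and r: "(z, \<beta>, t) \<in> persp_region f h" and pos: "\<And>i. z $ i > 0"
  shows "(z, \<beta>, t) \<in> convex hull (Z_set f h (Q_card 1))"
proof -
  let ?F = "\<lambda>i. f (h $ i * \<beta> $ i / z $ i)"
  define s where "s = t - (\<Sum>i\<in>UNIV. z $ i * ?F i)"
  define v :: "'p option \<Rightarrow> (real ^ 'p) \<times> (real ^ 'p) \<times> real"
    where "v k = (case k of None \<Rightarrow> (0, 0, s)
    | Some i \<Rightarrow> (axis i 1, axis i (\<beta> $ i / z $ i), ?F i + s))" for k
  define w :: "'p option \<Rightarrow> real"
    where "w k = (case k of None \<Rightarrow> 1 - (\<Sum>i\<in>UNIV. z $ i) | Some i \<Rightarrow> z $ i)" for k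
  have zsum: "(\<Sum>i\<in>UNIV. z $ i) \<le> 1"
    and "(\<Sum>i\<in>UNIV. persp f (z $ i) (h $ i * \<beta> $ i)) \<le> ereal t"
    using r by (auto simp: persp_region_def)
  moreover have "persp f (z $ i) (h $ i * \<beta> $ i) = ereal (z $ i * ?F i)" for i
    using pos[of i] by (simp add: persp_def)
  ultimately have s: "s \<ge> 0" by (simp add: s_def)
  have sum_option: "(\<Sum>k\<in>UNIV. g k) = g None + (\<Sum>i\<in>UNIV. g (Some i))"
    for g :: "'p option \<Rightarrow> 'b :: comm_monoid_add"
    by (simp add: UNIV_option_conv sum.reindex)
  have "v k \<in> Z_set f h (Q_card 1)" for k
  proof (cases k)
    case None
    then show ?thesis using s f0 by (simp add: v_def Z_set_def Q_card_def)
  next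
    case (Some i)
    have "(\<Sum>j\<in>UNIV. axis i (1::real) $ j) = 1"
      by (simp add: axis_def)
    with Some s show ?thesis
      by (auto simp: v_def Z_set_def Q_card_def inner_axis) (auto simp: axis_def)
  qed
  moreover have "w k \<ge> 0" for k
    using zsum pos by (auto simp: w_def less_imp_le split: option.split)
  moreover have "(\<Sum>k\<in>UNIV. w k) = 1"
    by (simp add: sum_option w_def)
  ultimately have "(\<Sum>k\<in>UNIV. w k *\<^sub>R v k) \<in> convex hull (Z_set f h (Q_card 1))"
    by (intro convex_sum) (auto intro: hull_inc convex_convex_hull)
  moreover have "(\<Sum>k\<in>UNIV. w k *\<^sub>R v k) = (z, \<beta>, t)"
  proof (intro prod_eqI)
    show "fst (\<Sum>k\<in>UNIV. w k *\<^sub>R v k) = fst (z, \<beta>, t)"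
      by (simp add: sum_option w_def v_def fst_sum vec_eq_iff axis_def if_distrib cong: if_cong)
    show "fst (snd (\<Sum>k\<in>UNIV. w k *\<^sub>R v k)) = fst (snd (z, \<beta>, t))"
      using pos[THEN less_imp_neq]
      by (simp add: sum_option w_def v_def fst_sum snd_sum vec_eq_iff axis_def if_distrib cong: if_cong)
    show "snd (snd (\<Sum>k\<in>UNIV. w k *\<^sub>R v k)) = snd (snd (z, \<beta>, t))"
      by (simp add: sum_option w_def v_def snd_sum distrib_left sum.distrib
          flip: sum_distrib_right) (simp add: s_def algebra_simps)
  qed
  ultimately show ?thesis by simp
qed

lemma barycentre_mem_persp_region:
  fixes h :: "real ^ 'p"
  assumes f0: "f 0 = 0"
  shows "((\<chi> i. 1 / real CARD('p)), 0, 0) \<in> persp_region f h"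
  using f0 by (simp add: persp_region_def persp_def divide_le_eq)

text \<open>
  Moving from \<open>r\<close> towards the barycentre makes every \<open>z\<^sub>i\<close> positive and keeps \<open>\<Sum>\<^sub>i z\<^sub>i \<le> 1\<close>, even
  if this bound is tight at \<open>r\<close>. Convexity of the region bounds the sum of perspectives along
  the segment, also when some of them are limits at \<open>z\<^sub>i = 0\<close>.
\<close>

lemma persp_region_subset_closure_hull:
  fixes h :: "real ^ 'p"
  assumes cv: "convex_on UNIV f" and f0: "f 0 = 0"
  shows "persp_region f h \<subseteq> closure (convex hull (Z_set f h (Q_card 1)))"
proof
  fix r assume r: "r \<in> persp_region f h"
  let ?b = "((\<chi> i. 1 / real CARD('p)), 0, 0) :: (real ^ 'p) \<times> (real ^ 'p) \<times> real"
  let ?r = "\<lambda>e :: real. (1 - e) *\<^sub>R r + e *\<^sub>R ?b"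
  have mem: "?r e \<in> convex hull (Z_set f h (Q_card 1))" if e: "0 < e" "e < 1" for e
  proof -
    have R: "?r e \<in> persp_region f h"
      using convexD[OF convex_persp_region[OF cv f0] r
        barycentre_mem_persp_region[where f = f and h = h, OF f0], of "1 - e" e] e
      by simp
    have "fst r $ i \<ge> 0" for i
      using r by (auto simp: persp_region_def)
    then have "fst (?r e) $ i > 0" for i
      using e by (auto intro!: add_nonneg_pos)
    with R show ?thesis
      by (metis f0 mem_hull_of_pos prod.collapse)
  qed
  have "(?r \<longlongrightarrow> (1 - 0) *\<^sub>R r + 0 *\<^sub>R ?b) (at_right 0)"
    by (intro tendsto_intros)
  then have "(?r \<longlongrightarrow> r) (at_right 0)" by (simp del: scaleR_Pair)
  moreover have "eventually (\<lambda>e. ?r e \<in> closure (convex hull (Z_set f h (Q_card 1)))) (at_right 0)"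
  proof (rule eventually_mono)
    show "eventually (\<lambda>e. e \<in> {0<..<1}) (at_right (0::real))"
      by (rule eventually_at_right_real) simp
  next
    fix e :: real assume "e \<in> {0<..<1}"
    then have "?r e \<in> convex hull (Z_set f h (Q_card 1))" by (intro mem) auto
    then show "?r e \<in> closure (convex hull (Z_set f h (Q_card 1)))"
      by (rule closure_subset[THEN subsetD])
  qed
  ultimately show "r \<in> closure (convex hull (Z_set f h (Q_card 1)))"
    by (intro Lim_in_closed_set[of _ ?r "at_right 0"]) auto
qed

theorem proposition5:
  fixes h :: "real ^ 'p" and f :: "real \<Rightarrow> real"
  assumes "\<And>i. h $ i \<noteq> 0"
    and "convex_on UNIV f"
    and "f 0 = 0"
  shows "closure (convex hull (Z_set f h (Q_card 1))) =
    {(z, \<beta>, t). (\<forall>i. z $ i \<in> {0..1}) \<and> (\<Sum>i\<in>UNIV. z $ i) \<le> 1 \<and>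
       (\<Sum>i\<in>UNIV. persp f (z $ i) (h $ i * \<beta> $ i)) \<le> ereal t}"
proof -
  have "closure (convex hull (Z_set f h (Q_card 1))) \<subseteq> persp_region f h"
    using assms(2,3)
    by (intro closure_minimal hull_minimal Z_set_subset_persp_region
        closed_persp_region convex_persp_region)
  with persp_region_subset_closure_hull[OF assms(2,3)] show ?thesis
    unfolding persp_region_def by blast
qed

end
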